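(* Let $M\ge 7$ be an integer congruent to $2$ or $3$ modulo $5$. Then $$ \begin{aligned} 1&+q^2\frac{t+q}{1-tq^{2}}+\frac{q^6}{(1-tq^2)(1-wq^M)}\left([M]_q+(w-1)(q^{M-3}+q^{M-6})\right)\\ &+\sum_{k=3}^{M-1}\frac{q^{k(k+1)}}{(1-tq^2)\prod_{i=3}^{k}(1-q^{i})}\cdot\frac{[M]_q}{1-wq^M}\\ &+\sum_{k=M}^\infty\frac{q^{k(k+1)}}{(1-tq^2)(1-wq^{M})\prod_{1\le i\le k,\ i\notin\{2,M\}}(1-q^i)}\\ &=\frac{1-q^{M}}{1-wq^{M}}\cdot\frac{1}{(1-tq^2)(1-q^3)}\prod_{k=1}^\infty\frac{1}{(1-q^{5k+2})(1-q^{5k+3})}. \end{aligned} $$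
   Context: $[n]_q=1+q+\cdots+q^{n-1}$ for a positive integer $n$. The identity is one of formal power series in $q$ with coefficients in $\mathbb{Z}[t,w]$. *)

theory Defs
  imports "HOL-Analysis.Analysis"
begin

text \<open>
  The coefficient ring \<open>\<int>[t,w]\<close> is represented as \<open>(\<int>[t])[w]\<close>, i.e. by the type
  \<open>int poly poly\<close>: \<open>w\<close> is the outer and \<open>t\<close> the inner polynomial variable.
\<close>

abbreviation q :: "int poly poly fps"
  where "q \<equiv> fps_X"

definition t :: "int poly poly fps"
  where "t = fps_const [:[:0, 1:]:]"

definition w :: "int poly poly fps"
  where "w = fps_const [:0, 1:]"

definition qint :: "nat \<Rightarrow> int poly poly fps"
  where "qint n = (\<Sum>i<n. q ^ i)"

text \<open>
  Since \<open>int poly poly\<close> is not a field, the library's division of power series is not available.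
  \<open>f \<oslash> g\<close> is the quotient for denominators \<open>g\<close> with constant coefficient \<open>1\<close>, which are
  units of \<open>\<int>[t,w][[q]]\<close>; it is meaningful for such \<open>g\<close> only.
\<close>

definition fps_quot :: "'a::comm_ring_1 fps \<Rightarrow> 'a fps \<Rightarrow> 'a fps"  (infixl \<open>\<oslash>\<close> 70)
  where "f \<oslash> g = f * fps_right_inverse g 1"

lemma fps_quot_mult_cancel:
  assumes "fps_nth g 0 = 1"
  shows   "(f \<oslash> g) * g = f"
proof -
  have "g * fps_right_inverse g 1 = 1"
    by (rule fps_right_inverse) (use assms in simp)
  thus ?thesis by (simp add: fps_quot_def mult_ac)
qed

lemma fps_quot_unique:
  assumes "fps_nth g 0 = 1" and "h * g = f"
  shows   "f \<oslash> g = h"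
proof -
  have "g * fps_right_inverse g 1 = 1"
    by (rule fps_right_inverse) (use assms in simp)
  thus ?thesis by (simp add: fps_quot_def assms(2)[symmetric] mult.assoc)
qed

text \<open>
  Infinite sums and products are taken with respect to the library's topology on \<open>fps\<close>, the
  \<open>q\<close>-adic one (coefficientwise eventual stabilisation). Lemmas \<open>summable_tail\<close> and \<open>convergent_prod_rhs\<close>
  show that \<open>suminf\<close> and \<open>prodinf\<close> give genuine limits for the series and the product at hand.
\<close>

lemma summable_fpsI:
  fixes f :: "nat \<Rightarrow> 'a::comm_ring_1 fps"
  assumes "\<And>n k. n < k \<Longrightarrow> fps_nth (f k) n = 0"
  shows   "summable f"
proof -
  have "(\<lambda>N. \<Sum>k<N. f k) \<longlonglongrightarrow> Abs_fps (\<lambda>n. \<Sum>k\<le>n. fps_nth (f k) n)"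
  proof (rule tendsto_fpsI)
    fix n
    show "\<forall>\<^sub>F N in sequentially. fps_nth (\<Sum>k<N. f k) n =
            fps_nth (Abs_fps (\<lambda>n. \<Sum>k\<le>n. fps_nth (f k) n)) n"
      using eventually_gt_at_top[of n]
    proof eventually_elim
      case (elim N)
      have "(\<Sum>k<N. fps_nth (f k) n) = (\<Sum>k\<le>n. fps_nth (f k) n)"
        by (rule sum.mono_neutral_right) (use elim assms in \<open>auto simp: not_le\<close>)
      thus ?case by (simp add: fps_sum_nth)
    qed
  qed
  thus ?thesis by (auto simp: summable_def sums_def)
qed

lemma convergent_prod_fpsI:
  fixes f :: "nat \<Rightarrow> 'a::comm_ring_1 fps"
  assumes f0: "\<And>k. fps_nth (f k) 0 = 1"
      and fn: "\<And>n k. 0 < n \<Longrightarrow> n \<le> k \<Longrightarrow> fps_nth (f k) n = 0"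
  shows   "convergent_prod f"
proof -
  define P where "P N = (\<Prod>k\<le>N. f k)" for N
  have P_step: "fps_nth (P (Suc N)) n = fps_nth (P N) n" if "n \<le> N" for n N
  proof -
    have "fps_nth (P (Suc N)) n = (\<Sum>i=0..n. fps_nth (P N) i * fps_nth (f (Suc N)) (n - i))"
      by (simp add: P_def fps_mult_nth)
    also have "\<dots> = (\<Sum>i=0..n. if i = n then fps_nth (P N) n else 0)"
      by (intro sum.cong) (use f0 fn that in auto)
    finally show ?thesis by simp
  qed
  have P_stable: "fps_nth (P N) n = fps_nth (P n) n" if "n \<le> N" for n N
    using that by (induction N rule: dec_induct) (simp_all add: P_step)
  define L where "L = Abs_fps (\<lambda>n. fps_nth (P n) n)"
  have "P \<longlonglongrightarrow> L"
  proof (rule tendsto_fpsI)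
    fix n
    show "\<forall>\<^sub>F N in sequentially. fps_nth (P N) n = fps_nth L n"
      using eventually_ge_at_top[of n] by eventually_elim (auto simp: L_def intro: P_stable)
  qed
  moreover have "fps_nth L 0 = 1"
    by (simp add: L_def P_def f0)
  hence "L \<noteq> 0" by auto
  ultimately have "raw_has_prod f 0 L"
    by (simp add: raw_has_prod_def P_def[abs_def])
  thus ?thesis by (auto simp: convergent_prod_def)
qed

lemma summable_tail:
  "summable (\<lambda>j. let k = M + j in
     q ^ (k * (k + 1)) \<oslash>
       ((1 - t * q ^ 2) * (1 - w * q ^ M) * (\<Prod>i\<in>{1..k} - {2, M}. 1 - q ^ i)))"
proof (rule summable_fpsI)
  fix n j :: nat
  assume "n < j"
  also have "j \<le> M + j" by simp
  also have "M + j \<le> (M + j) * (M + j + 1)" by simp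
  finally have less: "n < (M + j) * (M + j + 1)" .
  show "fps_nth (let k = M + j in
     q ^ (k * (k + 1)) \<oslash>
       ((1 - t * q ^ 2) * (1 - w * q ^ M) * (\<Prod>i\<in>{1..k} - {2, M}. 1 - q ^ i))) n = 0"
    unfolding Let_def fps_quot_def fps_X_power_mult_nth by (simp only: less if_True)
qed

lemma fps_quot_nth_low:
  assumes "n < m"
  shows   "fps_nth (1 \<oslash> ((1 - q ^ m) * (1 - q ^ (m + 1)))) n = (if n = 0 then 1 else 0)"
proof -
  define g r a b where "g = (1 - q ^ m) * (1 - q ^ (m + 1))" and "r = 1 \<oslash> g"
    and "a = q ^ m" and "b = 1 + q - q ^ (m + 1)"
  have "fps_nth g 0 = 1"
    using assms by (simp add: g_def fps_mult_nth)
  hence "r * g = 1"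
    unfolding r_def by (rule fps_quot_mult_cancel)
  moreover have "g = 1 - a * b"
    unfolding g_def a_def b_def power_add power_one_right by (simp add: algebra_simps)
  moreover have "r * (1 - a * b) = r - a * (b * r)"
    by (simp add: algebra_simps)
  ultimately have "r - a * (b * r) = 1"
    by (simp only:)
  hence "r = 1 + a * (b * r)"
    by (simp only: diff_eq_eq)
  hence "fps_nth r n = fps_nth (1 + q ^ m * (b * r)) n"
    by (simp add: a_def)
  also have "\<dots> = (if n = 0 then 1 else 0)"
    using assms by (simp only: fps_add_nth fps_X_power_mult_nth if_True) simp
  finally show ?thesis by (simp only: r_def g_def)
qed

lemma convergent_prod_rhs:
  "convergent_prod (\<lambda>j. let k = j + 1 in 1 \<oslash> ((1 - q ^ (5*k + 2)) * (1 - q ^ (5*k + 3))))"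
proof (rule convergent_prod_fpsI)
  fix j n :: nat
  have eq: "5 * k + 3 = 5 * k + 2 + (1::nat)" for k by simp
  show "fps_nth (let k = j + 1 in 1 \<oslash> ((1 - q ^ (5*k + 2)) * (1 - q ^ (5*k + 3)))) 0 = 1"
    unfolding Let_def eq by (subst fps_quot_nth_low) simp_all
  assume "0 < n" "n \<le> j"
  thus "fps_nth (let k = j + 1 in 1 \<oslash> ((1 - q ^ (5*k + 2)) * (1 - q ^ (5*k + 3)))) n = 0"
    unfolding Let_def eq by (subst fps_quot_nth_low) simp_all
qed

end

theory Submission
  imports Defs
begin

text \<open>
  Multiplied by \<open>(1 - t q^2) (1 - w q^M)\<close>, the left-hand side becomes
  \<open>(1 - q^2) (1 - q^M)\<close> times the sum of all \<open>q^(k(k+1)) / (q;q)_k\<close>: the parameters \<open>t\<close> and \<open>w\<close>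
  cancel among the terms that replace \<open>k = 0, 1, 2\<close>. The claim is therefore the second
  Rogers--Ramanujan identity in disguise.

  That identity is obtained by applying Bailey's lemma (relative to \<open>a = q\<close>) twice to the unit
  Bailey pair, which yields a finite identity for every \<open>n\<close>. A finite form of the Jacobi triple
  product, a case of the \<open>q\<close>-binomial theorem, evaluates the resulting alternating sum as
  \<open>n\<close> grows. All limits are replaced by congruences modulo \<open>q^n\<close>.
\<close>

subsection \<open>Congruences modulo powers of the variable\<close>

text \<open>Agreement of all coefficients below \<open>N\<close>, see \<open>fcong_iff_nth\<close>.
  Phrased as divisibility, it inherits compatibility with sums and products from
  \<open>dvd\<close>.\<close>

definition fcong :: "nat \<Rightarrow> 'a::comm_ring_1 fps \<Rightarrow> 'a fps \<Rightarrow> bool"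
  where "fcong N f g \<longleftrightarrow> fps_X ^ N dvd f - g"

lemma fcong_refl [simp, intro]: "fcong N f f"
  by (simp add: fcong_def)

lemma fcong_sym: "fcong N f g \<Longrightarrow> fcong N g f"
  unfolding fcong_def using dvd_minus_iff[of _ "f - g"] by simp

lemma fcong_trans [trans]: "fcong N f g \<Longrightarrow> fcong N g h \<Longrightarrow> fcong N f h"
  unfolding fcong_def using dvd_add[of _ "f - g" "g - h"] by simp

lemma fcong_mono: "fcong N f g \<Longrightarrow> M \<le> N \<Longrightarrow> fcong M f g"
  unfolding fcong_def using dvd_trans[OF le_imp_power_dvd] by blast

lemma fcong_mult: "fcong N f g \<Longrightarrow> fcong N f' g' \<Longrightarrow> fcong N (f * f') (g * g')"
proof -
  assume "fcong N f g" "fcong N f' g'"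
  hence "fps_X ^ N dvd (f - g) * f' + g * (f' - g')"
    unfolding fcong_def by (intro dvd_add dvd_mult dvd_mult2)
  thus ?thesis by (simp add: fcong_def algebra_simps)
qed

lemma fcong_add: "fcong N f g \<Longrightarrow> fcong N f' g' \<Longrightarrow> fcong N (f + f') (g + g')"
  unfolding fcong_def using dvd_add[of _ "f - g" "f' - g'"] by (simp add: algebra_simps)

lemma fcong_sum: "(\<And>x. x \<in> A \<Longrightarrow> fcong N (f x) (g x)) \<Longrightarrow> fcong N (sum f A) (sum g A)"
  by (induction A rule: infinite_finite_induct) (auto intro: fcong_add)

lemma one_quot_mult: "fps_nth g 0 = 1 \<Longrightarrow> g * (1 \<oslash> g) = 1"
  using fps_quot_mult_cancel[of g 1] by (simp add: mult.commute)

text \<open>A series with constant coefficient 1 is a unit, so multiplication by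
  \<open>1 \<oslash> h\<close> undoes the factor \<open>h\<close>.\<close>

lemma fcong_cancel_right:
  assumes "fcong N (f * h) (g * h)" "fps_nth h 0 = 1"
  shows   "fcong N f g"
  using fcong_mult[OF assms(1) fcong_refl[of N "1 \<oslash> h"]] one_quot_mult[OF assms(2)]
  by (simp add: mult.assoc)

lemma fcong_nth:
  assumes "fcong N f g" "n < N"
  shows   "fps_nth f n = fps_nth g n"
proof -
  obtain h where "f - g = fps_X ^ N * h"
    using assms(1) unfolding fcong_def by (elim dvdE)
  hence "fps_nth (f - g) n = 0"
    using assms(2) by (simp add: fps_X_power_mult_nth)
  thus ?thesis by simp
qed

lemma fcong_iff_nth: "fcong N f g \<longleftrightarrow> (\<forall>n<N. fps_nth f n = fps_nth g n)"
proof
  assume *: "\<forall>n<N. fps_nth f n = fps_nth g n"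
  have "f - g = fps_X ^ N * Abs_fps (\<lambda>n. fps_nth (f - g) (n + N))"
    by (rule fps_ext) (use * in \<open>simp add: fps_X_power_mult_nth\<close>)
  thus "fcong N f g"
    unfolding fcong_def by (metis dvd_triv_left)
qed (auto intro: fcong_nth)

lemma fcong_eqI: "(\<And>N. fcong N f g) \<Longrightarrow> f = g"
  by (rule fps_ext) (use fcong_nth in blast)

section \<open>Infinite sums and products modulo a power of the variable\<close>

lemma fcong_suminf:
  fixes f :: "nat \<Rightarrow> 'a::comm_ring_1 fps"
  assumes "\<And>k. fps_X ^ k dvd f k"
  shows   "fcong N (\<Sum>k. f k) (\<Sum>k<N. f k)"
  unfolding fcong_iff_nth
proof safe
  fix n assume n: "n < N"
  have z: "fps_nth (f k) m = 0" if "m < k" for m k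
    using fcong_nth[of k "f k" 0 m] assms[of k] that by (simp add: fcong_def)
  have "f sums (\<Sum>k. f k)"
    by (intro summable_sums summable_fpsI z)
  hence "\<forall>\<^sub>F K in sequentially. fps_nth (\<Sum>k<K. f k) n = fps_nth (\<Sum>k. f k) n"
    unfolding sums_def tendsto_fps_iff by blast
  then obtain K0 where K0: "\<And>K. K \<ge> K0 \<Longrightarrow> fps_nth (\<Sum>k<K. f k) n = fps_nth (\<Sum>k. f k) n"
    unfolding eventually_sequentially by blast
  have "fps_nth (\<Sum>k. f k) n = fps_nth (\<Sum>k<max K0 N. f k) n"
    by (rule K0[symmetric]) simp
  also have "\<dots> = fps_nth (\<Sum>k<N. f k) n"
    unfolding fps_sum_nth by (rule sum.mono_neutral_right) (use n z in auto)
  finally show "fps_nth (\<Sum>k. f k) n = fps_nth (\<Sum>k<N. f k) n" .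
qed

text \<open>Multiplication by \<open>f n\<close> leaves all coefficients up to degree
  \<open>n\<close> unchanged, so the partial products stabilise. Their limit has constant
  coefficient 1 and is therefore nonzero, as \<open>raw_has_prod\<close> demands.\<close>

lemma fcong_prodinf:
  fixes f :: "nat \<Rightarrow> 'a::idom fps"
  assumes f: "\<And>k. fcong (Suc k) (f k) 1"
  shows   "fcong N (\<Prod>k. f k) (\<Prod>k<N. f k)"
proof -
  have f_nth: "fps_nth (f k) m = (if m = 0 then 1 else 0)" if "m \<le> k" for m k
    using fcong_nth[OF f[of k], of m] that by simp
  hence nz: "f k \<noteq> 0" for k
    using f_nth[of 0 k] by (metis fps_zero_nth le0 zero_neq_one)
  have stable: "fcong K (\<Prod>k<n. f k) (\<Prod>k<K. f k)" if "K \<le> n" for n K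
    using that
  proof (induction n rule: dec_induct)
    case (step n)
    have "fcong K ((\<Prod>k<n. f k) * f n) ((\<Prod>k<K. f k) * 1)"
      by (intro fcong_mult step.IH fcong_mono[OF f]) (use step.hyps in simp)
    thus ?case by simp
  qed auto
  have lim: "(\<lambda>n. \<Prod>k\<le>n. f k) \<longlonglongrightarrow> Abs_fps (\<lambda>n. fps_nth (\<Prod>k<Suc n. f k) n)" (is "_ \<longlonglongrightarrow> ?L")
  proof (rule tendsto_fpsI)
    fix n
    show "\<forall>\<^sub>F K in sequentially. fps_nth (\<Prod>k\<le>K. f k) n = fps_nth ?L n"
      using eventually_ge_at_top[of n]
    proof eventually_elim
      case (elim K)
      show ?case
        using fcong_nth[OF stable[of "Suc n" "Suc K"], of n] elim
        by (simp add: lessThan_Suc_atMost)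
    qed
  qed
  have "fps_nth ?L 0 = 1"
    by (simp add: f_nth)
  hence "?L \<noteq> 0" by (metis fps_zero_nth zero_neq_one)
  with lim have "raw_has_prod f 0 ?L"
    by (simp add: raw_has_prod_def)
  \<comment> \<open>\<open>has_prod\<close> has a second alternative for products with a vanishing
    factor; \<open>nz\<close> excludes it.\<close>
  moreover from this have "p = ?L" if "f has_prod p" for p
    using that nz unfolding has_prod_def raw_has_prod_def by (auto intro: LIMSEQ_unique)
  ultimately have "prodinf f = ?L"
    unfolding prodinf_def by (intro the_equality) (auto simp: has_prod_def)
  moreover have "fcong N ?L (\<Prod>k<N. f k)"
    unfolding fcong_iff_nth using fcong_nth[OF stable[of "Suc _" N]] by (auto simp del: prod.lessThan_Suc simp: Suc_le_eq)
  ultimately show ?thesis by simp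
qed

text \<open>Modulo each power of the variable the series may be truncated, the finite sum
  rearranged, and the truncation undone. The next two lemmas follow the same pattern.\<close>

lemma suminf_fps_cmult:
  fixes f :: "nat \<Rightarrow> 'a::comm_ring_1 fps"
  assumes f: "\<And>k. fps_X ^ k dvd f k"
  shows   "(\<Sum>k. c * f k) = c * (\<Sum>k. f k)"
proof (rule fcong_eqI)
  fix N
  have "fcong N (\<Sum>k. c * f k) (\<Sum>k<N. c * f k)"
    by (intro fcong_suminf dvd_mult f)
  also have "(\<Sum>k<N. c * f k) = c * (\<Sum>k<N. f k)"
    by (simp add: sum_distrib_left)
  also have "fcong N \<dots> (c * (\<Sum>k. f k))"
    by (intro fcong_mult fcong_refl fcong_sym[OF fcong_suminf] f)
  finally show "fcong N (\<Sum>k. c * f k) (c * (\<Sum>k. f k))" .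
qed

lemma suminf_fps_shift:
  fixes f :: "nat \<Rightarrow> 'a::comm_ring_1 fps"
  assumes f: "\<And>k. fps_X ^ k dvd f k"
  shows   "(\<Sum>k. f k) = (\<Sum>k<M. f k) + (\<Sum>j. f (M + j))"
proof (rule fcong_eqI)
  fix N
  have f': "fps_X ^ j dvd f (M + j)" for j
    using f[of "M + j"] by (rule dvd_trans[OF le_imp_power_dvd, rotated]) simp
  have "fcong N (\<Sum>k. f k) (\<Sum>k<M+N. f k)"
    by (rule fcong_mono[OF fcong_suminf]) (auto intro: f)
  also have "(\<Sum>k<M+N. f k) = (\<Sum>k<M. f k) + (\<Sum>j<N. f (M + j))"
    by (induction N) (simp_all add: add.assoc)
  also have "fcong N \<dots> ((\<Sum>k<M. f k) + (\<Sum>j. f (M + j)))"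
    by (intro fcong_add fcong_refl fcong_sym[OF fcong_suminf] f')
  finally show "fcong N (\<Sum>k. f k) ((\<Sum>k<M. f k) + (\<Sum>j. f (M + j)))" .
qed

lemma prodinf_fps_split_head:
  fixes f :: "nat \<Rightarrow> 'a::idom fps"
  assumes f: "\<And>k. fcong (Suc k) (f k) 1"
  shows   "(\<Prod>k. f k) = f 0 * (\<Prod>k. f (Suc k))"
proof (rule fcong_eqI)
  fix N
  have f': "fcong (Suc k) (f (Suc k)) 1" for k
    by (rule fcong_mono[OF f]) simp
  have "fcong N (\<Prod>k. f k) (\<Prod>k<Suc N. f k)"
    by (rule fcong_mono[OF fcong_prodinf]) (auto intro: f)
  also have "(\<Prod>k<Suc N. f k) = f 0 * (\<Prod>k<N. f (Suc k))"
    by (rule prod.lessThan_Suc_shift)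
  also have "fcong N \<dots> (f 0 * (\<Prod>k. f (Suc k)))"
    by (intro fcong_mult fcong_refl fcong_sym[OF fcong_prodinf] f')
  finally show "fcong N (\<Prod>k. f k) (f 0 * (\<Prod>k. f (Suc k)))" .
qed

lemma fps_prod_nth_0: "fps_nth (prod f A) 0 = (\<Prod>x\<in>A. fps_nth (f x) 0)"
  for f :: "'b \<Rightarrow> 'a::comm_ring_1 fps"
  by (induction A rule: infinite_finite_induct) simp_all

subsection \<open>Gaussian binomial coefficients\<close>

text \<open>\<open>qpoch Q n\<close> is the \<open>q\<close>-Pochhammer symbol \<open>(Q;Q)_n\<close>.\<close>

definition qpoch :: "'a::comm_ring_1 \<Rightarrow> nat \<Rightarrow> 'a"
  where "qpoch Q n = (\<Prod>i=1..n. 1 - Q ^ i)"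

lemma qpoch_0 [simp]: "qpoch Q 0 = 1"
  by (simp add: qpoch_def)

lemma qpoch_Suc: "qpoch Q (Suc n) = qpoch Q n * (1 - Q ^ Suc n)"
  by (simp add: qpoch_def)

text \<open>The Gaussian binomial coefficient, given by a q-Pascal rule so that it makes sense in
  every commutative ring; \<open>gbin_qpoch\<close> recovers the product formula. Truncation of
  \<open>n - k\<close> is harmless, since \<open>gbin Q n k\<close> vanishes for
  \<open>k > n\<close>.\<close>

fun gbin :: "'a::comm_ring_1 \<Rightarrow> nat \<Rightarrow> nat \<Rightarrow> 'a" where
  "gbin Q n 0 = 1"
| "gbin Q 0 (Suc k) = 0"
| "gbin Q (Suc n) (Suc k) = gbin Q n (Suc k) + Q ^ (n - k) * gbin Q n k"

lemma gbin_eq_0: "n < k \<Longrightarrow> gbin Q n k = 0"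
  by (induction Q n k rule: gbin.induct) auto

text \<open>The two terms of the q-Pascal rule contribute the cofactors \<open>1 - Q^(n-k)\<close>
  and \<open>Q^(n-k) (1 - Q^(k+1))\<close>, which add up to \<open>1 - Q^(n+1)\<close>. For
  \<open>k = n\<close> the first term vanishes.\<close>

lemma gbin_qpoch:
  assumes "k \<le> n"
  shows   "gbin Q n k * qpoch Q k * qpoch Q (n - k) = qpoch Q n"
  using assms
proof (induction Q n k rule: gbin.induct)
  case (3 Q n k)
  have 2: "gbin Q n k * qpoch Q k * qpoch Q (n - k) = qpoch Q n"
    by (rule 3) (use 3 in simp)
  show ?case
  proof (cases "k = n")
    case True
    thus ?thesis using 2 by (simp add: gbin_eq_0 qpoch_Suc flip: mult.assoc)
  next
    case False
    with 3 obtain d where n: "n = k + Suc d"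
      using less_imp_Suc_add[of k n] by auto
    have 1: "gbin Q n (Suc k) * qpoch Q (Suc k) * qpoch Q d = qpoch Q n"
      using 3(1) by (simp add: n)
    have "gbin Q (Suc n) (Suc k) * qpoch Q (Suc k) * qpoch Q (Suc n - Suc k) =
          (gbin Q n (Suc k) * qpoch Q (Suc k) * qpoch Q d) * (1 - Q ^ Suc d)
          + Q ^ Suc d * (1 - Q ^ Suc k) * (gbin Q n k * qpoch Q k * qpoch Q (n - k))"
      by (simp add: n qpoch_Suc algebra_simps)
    also have "\<dots> = qpoch Q n * (1 - Q ^ (Suc d + Suc k))"
      unfolding 1 2 by (simp add: algebra_simps power_add)
    also have "Suc d + Suc k = Suc n"
      by (simp add: n)
    finally show ?thesis
      by (simp only: qpoch_Suc)
  qed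
qed auto

lemma choose_two_0: "0 choose 2 = 0"
  by (simp add: numeral_2_eq_2)

lemma choose_two_Suc: "Suc n choose 2 = n + (n choose 2)"
  by (simp add: numeral_2_eq_2)

text \<open>Induction multiplies by the last factor \<open>u - v * Q ^ n\<close>, and the q-Pascal
  rule matches coefficients. The homogeneous form allows a value of \<open>u\<close> that is not
  invertible, such as a power of the variable.\<close>

theorem q_binomial:
  "(\<Prod>k<n. u - v * Q ^ k) = (\<Sum>k\<le>n. gbin Q n k * (- 1) ^ k * Q ^ (k choose 2) * v ^ k * u ^ (n - k))"
proof (induction n)
  case (Suc n)
  define T where "T m k = gbin Q m k * (- 1) ^ k * Q ^ (k choose 2) * v ^ k" for m k
  have T_Suc: "T (Suc n) (Suc k) = T n (Suc k) - v * Q ^ n * T n k" if "k \<le> n" for k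
  proof -
    have "Q ^ (n - k) * Q ^ (Suc k choose 2) = Q ^ n * Q ^ (k choose 2)"
      using that by (simp add: choose_two_Suc flip: power_add)
    thus ?thesis
      unfolding T_def by (simp add: algebra_simps)
  qed
  have "(\<Sum>k\<le>Suc n. T (Suc n) k * u ^ (Suc n - k)) =
        u ^ Suc n + (\<Sum>k\<le>n. T (Suc n) (Suc k) * u ^ (n - k))"
    by (subst sum.atMost_Suc_shift) (simp add: T_def choose_two_0)
  also have "\<dots> = u ^ Suc n + (\<Sum>k\<le>n. T n (Suc k) * u ^ (n - k))
                 - v * Q ^ n * (\<Sum>k\<le>n. T n k * u ^ (n - k))"
    by (simp add: T_Suc algebra_simps sum_subtractf sum_distrib_left)
  also have "u ^ Suc n + (\<Sum>k\<le>n. T n (Suc k) * u ^ (n - k)) = (\<Sum>k\<le>Suc n. T n k * u ^ (Suc n - k))"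
    unfolding sum.atMost_Suc_shift by (simp add: T_def choose_two_0)
  also have "\<dots> = u * (\<Sum>k\<le>n. T n k * u ^ (n - k))"
    by (simp add: T_def gbin_eq_0 sum_distrib_left Suc_diff_le mult_ac)
  finally show ?case
    using Suc by (simp add: T_def algebra_simps)
qed (simp add: choose_two_0)

text \<open>A limiting case of the q-Chu-Vandermonde summation, where \<open>r n\<close> stands for
  \<open>1 / (Q;Q)_n\<close> and enters only through its recurrence. With \<open>S N c\<close> for
  the left-hand side, the q-Pascal rule gives
  \<open>S (N+1) c = S N c + Q^(N+c+1) * S N (c+1)\<close>; hence \<open>c\<close> must vary in the
  induction.\<close>

lemma sum_gbin_vandermonde:
  assumes r: "\<And>n. r n = (1 - Q ^ Suc n) * r (Suc n)"
  shows   "(\<Sum>i\<le>N. Q ^ (i * (i + c)) * gbin Q N i * r (i + c)) = r (N + c)"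
proof (induction N arbitrary: c)
  case (Suc N)
  have step: "Q ^ (Suc i * (Suc i + c)) * gbin Q (Suc N) (Suc i) * r (Suc i + c) =
        Q ^ (Suc i * (Suc i + c)) * gbin Q N (Suc i) * r (Suc i + c) +
        Q ^ Suc (N + c) * (Q ^ (i * (i + Suc c)) * gbin Q N i * r (i + Suc c))" if "i \<le> N" for i
  proof -
    have "Suc i * (Suc i + c) + (N - i) = Suc (N + c) + i * (i + Suc c)"
      using that by (simp add: algebra_simps)
    hence "Q ^ (Suc i * (Suc i + c)) * Q ^ (N - i) = Q ^ Suc (N + c) * Q ^ (i * (i + Suc c))"
      by (metis power_add)
    thus ?thesis
      by (simp only: gbin.simps ring_distribs add_Suc add_Suc_right) (simp only: mult.assoc [symmetric])
  qed
  have "(\<Sum>i\<le>Suc N. Q ^ (i * (i + c)) * gbin Q (Suc N) i * r (i + c)) =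
        (r c + (\<Sum>i\<le>N. Q ^ (Suc i * (Suc i + c)) * gbin Q N (Suc i) * r (Suc i + c))) +
        Q ^ Suc (N + c) * (\<Sum>i\<le>N. Q ^ (i * (i + Suc c)) * gbin Q N i * r (i + Suc c))"
    unfolding sum.atMost_Suc_shift sum_distrib_left add.assoc sum.distrib [symmetric]
    by (intro arg_cong2[of _ _ _ _ "(+)"] sum.cong) (simp_all only: step atMost_iff, simp)
  also have "(\<Sum>i\<le>N. Q ^ (i * (i + Suc c)) * gbin Q N i * r (i + Suc c)) = r (N + Suc c)"
    by (rule Suc)
  also have "r c + (\<Sum>i\<le>N. Q ^ (Suc i * (Suc i + c)) * gbin Q N (Suc i) * r (Suc i + c)) =
        (\<Sum>i\<le>Suc N. Q ^ (i * (i + c)) * gbin Q N i * r (i + c))"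
    by (subst sum.atMost_Suc_shift) simp
  also have "\<dots> = r (N + c)"
    using Suc[of c] by (simp add: gbin_eq_0)
  also have "r (N + c) + Q ^ Suc (N + c) * r (N + Suc c) = r (Suc N + c)"
    using r[of "N + c"] by (simp add: algebra_simps)
  finally show ?case .
qed simp

subsection \<open>Bailey pairs relative to q\<close>

definition rpoch :: "nat \<Rightarrow> 'a::comm_ring_1 fps"
  where "rpoch n = 1 \<oslash> qpoch fps_X n"

lemma qpoch_nth_0:
  fixes Q :: "'a::comm_ring_1 fps"
  assumes "fps_nth Q 0 = 0"
  shows   "fps_nth (qpoch Q n) 0 = 1"
  using assms by (induction n) (simp_all add: qpoch_Suc)

lemma qpoch_rpoch: "qpoch fps_X n * rpoch n = 1"
  unfolding rpoch_def by (intro one_quot_mult qpoch_nth_0) simp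

lemma rpoch_0 [simp]: "rpoch 0 = 1"
  using qpoch_rpoch[of 0] by simp

lemma rpoch_Suc: "rpoch n = (1 - fps_X ^ Suc n) * rpoch (Suc n)"
proof -
  have "rpoch n * (qpoch fps_X (Suc n) * rpoch (Suc n)) = rpoch n"
    by (simp only: qpoch_rpoch mult_1_right)
  hence "(qpoch fps_X n * rpoch n) * ((1 - fps_X ^ Suc n) * rpoch (Suc n)) = rpoch n"
    by (simp only: qpoch_Suc mult_ac)
  thus ?thesis by (metis qpoch_rpoch mult_1_left)
qed

lemma gbin_rpoch: "k \<le> n \<Longrightarrow> gbin fps_X n k * rpoch n = rpoch k * rpoch (n - k)"
proof -
  assume k: "k \<le> n"
  have "rpoch k * rpoch (n - k) = (gbin fps_X n k * qpoch fps_X k * qpoch fps_X (n - k)) * rpoch n * rpoch k * rpoch (n - k)"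
    by (simp add: gbin_qpoch[OF k] qpoch_rpoch)
  also have "\<dots> = gbin fps_X n k * rpoch n * (qpoch fps_X k * rpoch k) * (qpoch fps_X (n - k) * rpoch (n - k))"
    by (simp only: mult_ac)
  also have "\<dots> = gbin fps_X n k * rpoch n"
    by (simp only: qpoch_rpoch mult_1_right)
  finally show ?thesis ..
qed

lemma sum_rpoch_vandermonde:
  "(\<Sum>i\<le>N. fps_X ^ (i * (i + c)) * rpoch (N - i) * rpoch i * rpoch (i + c)) = (rpoch N * rpoch (N + c) :: 'a::comm_ring_1 fps)"
proof -
  have "(\<Sum>i\<le>N. fps_X ^ (i * (i + c)) * rpoch (N - i) * rpoch i * rpoch (i + c)) =
        rpoch N * (\<Sum>i\<le>N. fps_X ^ (i * (i + c)) * gbin fps_X N i * rpoch (i + c) :: 'a fps)"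
    unfolding sum_distrib_left
  proof (rule sum.cong)
    fix i assume "i \<in> {..N}"
    hence "gbin fps_X N i * rpoch N = rpoch i * (rpoch (N - i) :: 'a fps)"
      by (simp add: gbin_rpoch)
    hence "fps_X ^ (i * (i + c)) * (rpoch i * rpoch (N - i)) * rpoch (i + c) =
           fps_X ^ (i * (i + c)) * (gbin fps_X N i * rpoch N) * (rpoch (i + c) :: 'a fps)"
      by (simp only:)
    thus "fps_X ^ (i * (i + c)) * rpoch (N - i) * rpoch i * rpoch (i + c) =
          rpoch N * (fps_X ^ (i * (i + c)) * gbin fps_X N i * rpoch (i + c) :: 'a fps)"
      by (simp only: mult_ac)
  qed simp
  thus ?thesis
    by (simp only: sum_gbin_vandermonde[of rpoch, OF rpoch_Suc])
qed

text \<open>After interchanging the summations, the inner sum over \<open>s\<close> is a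
  q-Vandermonde sum with shift \<open>2m + 1\<close>. This is Bailey's lemma with both free
  parameters sent to infinity; its conclusion again has the shape of the hypothesis, so it can be
  iterated. In contrast to the usual normalisation, \<open>\<alpha>\<close> absorbs the factor
  \<open>1 - q\<close>.\<close>

lemma bailey:
  assumes \<beta>: "\<And>s. \<beta> s = (\<Sum>m\<le>s. \<alpha> m * rpoch (s - m) * rpoch (s + m + 1))"
  shows   "(\<Sum>s\<le>n. fps_X ^ (s * (s + 1)) * rpoch (n - s) * \<beta> s) =
           (\<Sum>m\<le>n. (fps_X ^ (m * (m + 1)) * \<alpha> m) * rpoch (n - m) * rpoch (n + m + 1))"
proof -
  have inner: "(\<Sum>s=m..n. fps_X ^ (s * (s + 1)) * rpoch (n - s) * rpoch (s - m) * rpoch (s + m + 1)) =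
               fps_X ^ (m * (m + 1)) * rpoch (n - m) * rpoch (n + m + 1)" if "m \<le> n" for m
  proof -
    \<comment> \<open>For \<open>s = i + m\<close> the exponent \<open>s(s+1)\<close> splits into
      \<open>m(m+1)\<close>, which is passed on to the new \<open>\<alpha>\<close>, and the
      Vandermonde exponent for \<open>c = 2m + 1\<close>.\<close>
    have exp: "fps_X ^ ((i + m) * (i + m + 1)) = fps_X ^ (m * (m + 1)) * fps_X ^ (i * (i + (2 * m + 1)))" for i
      by (simp add: algebra_simps flip: power_add)
    have "(\<Sum>s=m..n. fps_X ^ (s * (s + 1)) * rpoch (n - s) * rpoch (s - m) * rpoch (s + m + 1)) =
          (\<Sum>i\<le>n - m. fps_X ^ (m * (m + 1)) *
             (fps_X ^ (i * (i + (2 * m + 1))) * rpoch (n - m - i) * rpoch i * rpoch (i + (2 * m + 1))))"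
    proof (rule sum.reindex_bij_witness[of _ "\<lambda>i. i + m" "\<lambda>s. s - m"])
      fix s assume "s \<in> {m..n}"
      then obtain i where s: "s = i + m" by (metis atLeastAtMost_iff le_add_diff_inverse2)
      show "fps_X ^ (m * (m + 1)) * (fps_X ^ ((s - m) * (s - m + (2 * m + 1))) * rpoch (n - m - (s - m)) *
              rpoch (s - m) * rpoch (s - m + (2 * m + 1))) =
            fps_X ^ (s * (s + 1)) * rpoch (n - s) * rpoch (s - m) * rpoch (s + m + 1)"
        unfolding s exp by (simp add: mult_ac add_ac flip: mult_2)
    qed (use that in auto)
    also have "\<dots> = fps_X ^ (m * (m + 1)) * (rpoch (n - m) * rpoch (n - m + (2 * m + 1)))"
      by (simp only: sum_distrib_left [symmetric] sum_rpoch_vandermonde)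
    also have "n - m + (2 * m + 1) = n + m + 1"
      using that by simp
    finally show ?thesis by (simp only: mult.assoc)
  qed
  have "(\<Sum>s\<le>n. fps_X ^ (s * (s + 1)) * rpoch (n - s) * \<beta> s) =
        (\<Sum>s\<le>n. \<Sum>m\<le>s. \<alpha> m * (fps_X ^ (s * (s + 1)) * rpoch (n - s) * rpoch (s - m) * rpoch (s + m + 1)))"
    by (simp only: \<beta> sum_distrib_left mult_ac)
  also have "\<dots> = (\<Sum>m\<le>n. \<Sum>s=m..n. \<alpha> m * (fps_X ^ (s * (s + 1)) * rpoch (n - s) * rpoch (s - m) * rpoch (s + m + 1)))"
    unfolding sum.Sigma[OF finite_atMost ballI[OF finite_atMost]]
      sum.Sigma[OF finite_atMost ballI[OF finite_atLeastAtMost]]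
    by (rule sum.reindex_bij_witness[of _ "\<lambda>(m, s). (s, m)" "\<lambda>(s, m). (m, s)"]) auto
  also have "\<dots> = (\<Sum>m\<le>n. \<alpha> m * (fps_X ^ (m * (m + 1)) * rpoch (n - m) * rpoch (n + m + 1)))"
    by (intro sum.cong refl) (simp only: sum_distrib_left [symmetric] inner atMost_iff)
  finally show ?thesis by (simp only: mult_ac)
qed

text \<open>
  The sum telescopes: \<open>1 - q^s\<close> times its partial sum up to \<open>k < s\<close> has the closed form \<open>partial\<close>,
  which the last summand cancels when \<open>k = s - 1\<close>.
\<close>

lemma unit_bailey_pair:
  "(if s = 0 then 1 else 0) =
     (\<Sum>m\<le>s. ((- 1) ^ m * fps_X ^ (m choose 2) * (1 - fps_X ^ (2 * m + 1))) * rpoch (s - m) * rpoch (s + m + 1)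
        :: 'a::idom fps)"
proof (cases s)
  case 0
  thus ?thesis using rpoch_Suc[of 0] by (simp add: numeral_2_eq_2)
next
  case (Suc s')
  define T :: "nat \<Rightarrow> 'a fps" where
    "T m = ((- 1) ^ m * fps_X ^ (m choose 2) * (1 - fps_X ^ (2 * m + 1))) * rpoch (s - m) * rpoch (s + m + 1)" for m
  have partial: "(1 - fps_X ^ s) * (\<Sum>m\<le>k. T m) =
      (- 1) ^ k * fps_X ^ (Suc k choose 2) * (1 - fps_X ^ Suc k) * rpoch (s - Suc k) * rpoch (s + k + 1)"
    if "k < s" for k
    using that
  proof (induction k)
    case 0
    have "rpoch (s - Suc 0) = (1 - fps_X ^ s) * (rpoch s :: 'a fps)"
      using rpoch_Suc[of "s - 1"] 0 by simp
    thus ?case by (simp add: T_def numeral_2_eq_2 mult_ac)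
  next
    case (Suc k)
    define d where "d = s - Suc (Suc k)"
    have s: "s = Suc (Suc k) + d" using Suc.prems by (simp add: d_def)
    have IH: "(1 - fps_X ^ s) * (\<Sum>m\<le>k. T m) =
      (- 1) ^ k * fps_X ^ (Suc k choose 2) * (1 - fps_X ^ Suc k) * rpoch (s - Suc k) * rpoch (s + k + 1)"
      using Suc by simp
    have r1: "rpoch (s + k + 1) = (1 - fps_X ^ (s + Suc k + 1)) * (rpoch (s + Suc k + 1) :: 'a fps)"
      using rpoch_Suc[of "s + k + 1"] by simp
    have r2: "rpoch d = (1 - fps_X ^ (s - Suc k)) * (rpoch (s - Suc k) :: 'a fps)"
      using rpoch_Suc[of d] by (simp add: s)
    \<comment> \<open>This combines the closed form at \<open>k\<close> with the next summand into
      the closed form at \<open>k + 1\<close>; the power \<open>y ^ Suc k\<close> raises the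
      exponent to \<open>Suc (Suc k) choose 2\<close>.\<close>
    have factor: "(1 - y ^ s) * (1 - y ^ (2 * Suc k + 1)) - (1 - y ^ Suc k) * (1 - y ^ (s + Suc k + 1)) =
               y ^ Suc k * (1 - y ^ Suc (Suc k)) * (1 - y ^ (s - Suc k))" for y :: "'a fps"
      by (simp add: s algebra_simps power_add mult_2_right)
    have "(1 - fps_X ^ s) * (\<Sum>m\<le>Suc k. T m) =
          (- 1) ^ k * fps_X ^ (Suc k choose 2) * (1 - fps_X ^ Suc k) * rpoch (s - Suc k) * rpoch (s + k + 1) +
          (1 - fps_X ^ s) * T (Suc k)"
      by (simp only: sum.atMost_Suc distrib_left IH)
    also have "\<dots> = (- 1) ^ Suc k * fps_X ^ (Suc k choose 2) * rpoch (s - Suc k) * rpoch (s + Suc k + 1) *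
          ((1 - fps_X ^ s) * (1 - fps_X ^ (2 * Suc k + 1)) - (1 - fps_X ^ Suc k) * (1 - fps_X ^ (s + Suc k + 1)))"
      unfolding r1 T_def by (simp add: algebra_simps)
    also have "(1 - fps_X ^ s) * (1 - fps_X ^ (2 * Suc k + 1)) - (1 - fps_X ^ Suc k) * (1 - fps_X ^ (s + Suc k + 1)) =
               fps_X ^ Suc k * (1 - fps_X ^ Suc (Suc k)) * (1 - fps_X ^ (s - Suc k) :: 'a fps)"
      by (rule factor)
    also have "(- 1) ^ Suc k * fps_X ^ (Suc k choose 2) * rpoch (s - Suc k) * rpoch (s + Suc k + 1) * \<dots> =
        (- 1) ^ Suc k * (fps_X ^ Suc k * fps_X ^ (Suc k choose 2)) * (1 - fps_X ^ Suc (Suc k)) *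
        ((1 - fps_X ^ (s - Suc k)) * rpoch (s - Suc k)) * rpoch (s + Suc k + 1)"
      by (simp only: mult_ac)
    finally show ?case
      unfolding r2 [symmetric] power_add [symmetric] choose_two_Suc[of "Suc k", symmetric] d_def .
  qed
  have "(1 - fps_X ^ s) * (\<Sum>m\<le>s. T m) = 0"
  proof -
    have sumS: "(\<Sum>m\<le>s. T m) = (\<Sum>m\<le>s'. T m) + T s"
      by (simp add: Suc)
    have r1: "rpoch (s + s' + 1) = (1 - fps_X ^ (2 * s + 1)) * (rpoch (s + s + 1) :: 'a fps)"
      using rpoch_Suc[of "s + s' + 1"] by (simp add: Suc mult_2)
    have p: "(1 - fps_X ^ s) * (\<Sum>m\<le>s'. T m) =
        (- 1) ^ s' * fps_X ^ (s choose 2) * (1 - fps_X ^ s) * rpoch (s + s' + 1)"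
      using partial[of s'] by (simp add: Suc)
    have sgn: "(- 1) ^ s = - ((- 1) ^ s' :: 'a fps)"
      by (simp add: Suc)
    have "(1 - fps_X ^ s) * (\<Sum>m\<le>s. T m) = (1 - fps_X ^ s) * (\<Sum>m\<le>s'. T m) + (1 - fps_X ^ s) * T s"
      by (simp only: sumS distrib_left)
    also have "\<dots> = 0"
      unfolding p unfolding r1 T_def sgn by (simp add: algebra_simps)
    finally show ?thesis .
  qed
  moreover have "fps_nth (1 - fps_X ^ s :: 'a fps) 0 \<noteq> 0"
    by (simp add: Suc)
  hence "(1 - fps_X ^ s :: 'a fps) \<noteq> 0"
    by (metis fps_zero_nth)
  ultimately have "(\<Sum>m\<le>s. T m) = 0"
    using mult_eq_0_iff by blast
  thus ?thesis
    by (simp only: T_def Suc) simp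
qed

text \<open>
  The exponent \<open>m(m-1)/2 + 2m(m+1)\<close> equals \<open>m(5m+3)/2\<close>, and replacing \<open>m\<close> by \<open>-m-1\<close> there adds
  \<open>2m+1\<close>: the last factor folds a bilateral theta series into a sum over \<open>m \<ge> 0\<close>.
\<close>

definition rr_term :: "nat \<Rightarrow> 'a::comm_ring_1 fps"
  where "rr_term m = (- 1) ^ m * fps_X ^ ((m choose 2) + 2 * (m * (m + 1))) * (1 - fps_X ^ (2 * m + 1))"

text \<open>The unit pair has \<open>\<beta>\<close> concentrated at 0, so one application of
  \<open>bailey\<close> produces \<open>\<beta> s = rpoch s\<close>, and a second one this identity.
  Each multiplies \<open>\<alpha> m\<close> by \<open>q^(m(m+1))\<close>, which turns it into
  \<open>rr_term m\<close>.\<close>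

lemma finite_rogers_ramanujan:
  "(\<Sum>s\<le>n. fps_X ^ (s * (s + 1)) * rpoch (n - s) * rpoch s) =
   (\<Sum>m\<le>n. rr_term m * rpoch (n - m) * rpoch (n + m + 1) :: 'a::idom fps)"
proof -
  define \<alpha> :: "nat \<Rightarrow> 'a fps" where "\<alpha> m = (- 1) ^ m * fps_X ^ (m choose 2) * (1 - fps_X ^ (2 * m + 1))" for m
  have "(\<Sum>s\<le>n. fps_X ^ (s * (s + 1)) * rpoch (n - s) * (if s = 0 then 1 else 0)) =
        (rpoch n :: 'a fps)" for n
  proof -
    have "(\<Sum>s\<le>n. fps_X ^ (s * (s + 1)) * rpoch (n - s) * (if s = 0 then 1 else 0)) =
          (\<Sum>s\<le>n. if s = 0 then rpoch n else 0 :: 'a fps)"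
      by (intro sum.cong) auto
    thus ?thesis by simp
  qed
  hence r: "rpoch s = (\<Sum>m\<le>s. (fps_X ^ (m * (m + 1)) * \<alpha> m) * rpoch (s - m) * rpoch (s + m + 1))" for s
    using bailey[of "\<lambda>s. if s = 0 then 1 else 0" \<alpha> s, OF unit_bailey_pair[where 'a='a, folded \<alpha>_def]] by simp
  have e: "fps_X ^ (m * (m + 1)) * (fps_X ^ (m * (m + 1)) * \<alpha> m) = rr_term m" for m
    unfolding rr_term_def \<alpha>_def mult_2 power_add by (simp only: mult_ac)
  show ?thesis
    using bailey[OF r, of n] by (simp only: e)
qed

subsection \<open>A finite Jacobi triple product\<close>

lemma choose_two_add: "(m + n) choose 2 = (m choose 2) + (n choose 2) + m * n"
  by (induction m) (simp_all add: choose_two_Suc choose_two_0)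

lemma square_choose_two: "n * n = 2 * (n choose 2) + n"
  by (induction n) (simp_all add: choose_two_Suc choose_two_0)

text \<open>Pairs the indices \<open>n - j\<close> and \<open>n + j + 1\<close>, which add up to
  \<open>2n + 1\<close> and so carry equal Gaussian binomials in the application.\<close>

lemma sum_fold_middle:
  fixes f :: "nat \<Rightarrow> 'a::comm_monoid_add"
  shows "(\<Sum>i\<le>2 * n + 1. f i) = (\<Sum>j\<le>n. f (n - j) + f (n + j + 1))"
proof -
  have split: "{..2 * n + 1} = {..n} \<union> {n + 1..2 * n + 1}"
    by auto
  have "(\<Sum>i\<le>2 * n + 1. f i) = (\<Sum>i\<in>{..n}. f i) + (\<Sum>i\<in>{n+1..2*n+1}. f i)"
    unfolding split by (rule sum.union_disjoint) auto
  also have "(\<Sum>i\<in>{..n}. f i) = (\<Sum>j\<le>n. f (n - j))"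
    by (rule sum.reindex_bij_witness[of _ "\<lambda>j. n - j" "\<lambda>j. n - j"]) auto
  also have "(\<Sum>i\<in>{n+1..2*n+1}. f i) = (\<Sum>j\<le>n. f (n + j + 1))"
    by (rule sum.reindex_bij_witness[of _ "\<lambda>j. n + j + 1" "\<lambda>i. i - (n + 1)"]) auto
  finally show ?thesis by (simp add: sum.distrib)
qed

text \<open>The product formula is symmetric, unlike the defining recursion; its Pochhammer factors
  have constant coefficient 1 and can be cancelled.\<close>

lemma gbin_sym:
  fixes Q :: "'a::comm_ring_1 fps"
  assumes "fps_nth Q 0 = 0" "k \<le> n"
  shows   "gbin Q n k = gbin Q n (n - k)"
proof -
  define u where "u = qpoch Q k * qpoch Q (n - k)"
  have "fps_nth u 0 = 1"
    using qpoch_nth_0[OF assms(1)] by (simp add: u_def)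
  hence u: "u * (1 \<oslash> u) = 1"
    by (rule one_quot_mult)
  have "gbin Q n k * u = gbin Q n (n - k) * u"
    using gbin_qpoch[of k n Q] gbin_qpoch[of "n - k" n Q] assms(2) by (simp add: u_def mult_ac)
  hence "gbin Q n k * (u * (1 \<oslash> u)) = gbin Q n (n - k) * (u * (1 \<oslash> u))"
    by (simp only: mult.assoc [symmetric])
  thus ?thesis by (simp only: u mult_1_right)
qed

lemma prod_fps_X_power: "(\<Prod>k<n. fps_X ^ (5 * k + 1) :: 'a::comm_ring_1 fps) = fps_X ^ (5 * (n choose 2) + n)"
  by (induction n) (simp_all add: choose_two_Suc choose_two_0 algebra_simps flip: power_add power_Suc)

text \<open>
  The \<open>q\<close>-binomial theorem for \<open>2n + 1\<close> factors in base \<open>q^5\<close> with \<open>u = q^(5n)\<close> and \<open>v = q\<close>; both sides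
  contain the factor \<open>c\<close>, which is cancelled.
\<close>

lemma finite_jacobi_triple_product:
  "(\<Prod>k<n. 1 - fps_X ^ (5 * k + 4)) * (\<Prod>k\<le>n. 1 - fps_X ^ (5 * k + 1)) =
   (\<Sum>j\<le>n. rr_term j * gbin (fps_X ^ 5) (2 * n + 1) (n - j) :: 'a::idom fps)"
proof -
  \<comment> \<open>The total exponent of the monomials pulled out of the \<open>2n + 1\<close>
    factors below: \<open>5k + 1\<close> for each \<open>k < n\<close>, and \<open>5n\<close> for
    each of the other \<open>n + 1\<close> factors.\<close>
  define E where "E = 5 * (n choose 2) + n + 5 * n * (n + 1)"
  define g :: "nat \<Rightarrow> 'a fps" where "g = gbin (fps_X ^ 5) (2 * n + 1)"
  define c :: "'a fps" where "c = (- 1) ^ n * fps_X ^ E"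
  define P :: "'a fps" where "P = (\<Prod>k<n. 1 - fps_X ^ (5 * k + 4)) * (\<Prod>k\<le>n. 1 - fps_X ^ (5 * k + 1))"
  have split: "{..<2 * n + 1} = {..<n} \<union> {n..2 * n}"
    by auto
  have "(\<Prod>k<2 * n + 1. fps_X ^ (5 * n) - fps_X * (fps_X ^ 5) ^ k :: 'a fps) =
        (\<Prod>k<n. fps_X ^ (5 * n) - fps_X * (fps_X ^ 5) ^ k) *
        (\<Prod>k\<in>{n..2*n}. fps_X ^ (5 * n) - fps_X * (fps_X ^ 5) ^ k)"
    unfolding split by (rule prod.union_disjoint) auto
  \<comment> \<open>For \<open>k < n\<close> the monomial of lower degree is
    \<open>q^(5k+1)\<close>, pulled out with a sign; for \<open>k \<ge> n\<close> it is
    \<open>q^(5n)\<close>. The remaining exponents are 4 and 1 modulo 5, respectively.\<close>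
  also have "(\<Prod>k<n. fps_X ^ (5 * n) - fps_X * (fps_X ^ 5) ^ k :: 'a fps) =
             (\<Prod>k<n. - (fps_X ^ (5 * k + 1)) * (1 - fps_X ^ (5 * (n - Suc k) + 4)))"
  proof (rule prod.cong)
    fix k assume "k \<in> {..<n}"
    then obtain d where n: "n = Suc (k + d)" using less_imp_Suc_add by auto
    show "fps_X ^ (5 * n) - fps_X * (fps_X ^ 5) ^ k =
          - (fps_X ^ (5 * k + 1)) * (1 - fps_X ^ (5 * (n - Suc k) + 4) :: 'a fps)"
      by (simp add: n algebra_simps flip: power_mult power_add power_Suc)
  qed simp
  also have "\<dots> = (- 1) ^ n * fps_X ^ (5 * (n choose 2) + n) * (\<Prod>k<n. 1 - fps_X ^ (5 * (n - Suc k) + 4))"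
    by (simp only: prod.distrib prod_uminus prod_fps_X_power card_lessThan)
  also have "(\<Prod>k<n. 1 - fps_X ^ (5 * (n - Suc k) + 4) :: 'a fps) = (\<Prod>k<n. 1 - fps_X ^ (5 * k + 4))"
    by (rule prod.nat_diff_reindex)
  also have "(\<Prod>k\<in>{n..2*n}. fps_X ^ (5 * n) - fps_X * (fps_X ^ 5) ^ k :: 'a fps) =
             (\<Prod>k\<le>n. fps_X ^ (5 * n) * (1 - fps_X ^ (5 * k + 1)))"
    by (rule prod.reindex_bij_witness[of _ "\<lambda>j. n + j" "\<lambda>i. i - n"])
       (auto simp: algebra_simps simp flip: power_mult power_add power_Suc)
  also have "\<dots> = fps_X ^ (5 * n * (n + 1)) * (\<Prod>k\<le>n. 1 - fps_X ^ (5 * k + 1))"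
    by (simp only: prod.distrib prod_constant card_atMost Suc_eq_plus1 power_mult)
  finally have lhs: "(\<Prod>k<2 * n + 1. fps_X ^ (5 * n) - fps_X * (fps_X ^ 5) ^ k :: 'a fps) = c * P"
    by (simp only: c_def P_def E_def power_add mult_ac)

  define h :: "nat \<Rightarrow> 'a fps"
    where "h k = g k * (- 1) ^ k * (fps_X ^ 5) ^ (k choose 2) * fps_X ^ k * (fps_X ^ (5 * n)) ^ (2 * n + 1 - k)" for k
  have h: "h k = g k * (- 1) ^ k * fps_X ^ (5 * (k choose 2) + k + 5 * n * (2 * n + 1 - k))" for k
    unfolding h_def by (simp only: power_mult [symmetric] power_add mult_ac)
  \<comment> \<open>Paired terms have equal Gaussian binomials, opposite signs, and exponents that
    differ by \<open>2j + 1\<close>; this produces the last factor of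
    \<open>rr_term j\<close>.\<close>
  have "h (n - j) + h (n + j + 1) = c * (rr_term j * g (n - j))" if "j \<le> n" for j
  proof -
    from that obtain d where n: "n = j + d" by (rule less_eqE)
    have e1: "5 * ((n - j) choose 2) + (n - j) + 5 * n * (2 * n + 1 - (n - j)) =
              E + ((j choose 2) + 2 * (j * (j + 1)))"
      using square_choose_two[of j] by (simp add: E_def n choose_two_add algebra_simps)
    have e2: "5 * ((n + j + 1) choose 2) + (n + j + 1) + 5 * n * (2 * n + 1 - (n + j + 1)) =
              E + ((j choose 2) + 2 * (j * (j + 1))) + (2 * j + 1)"
      using square_choose_two[of j] by (simp add: E_def n choose_two_add choose_two_Suc algebra_simps)
    have g: "g (n + j + 1) = g (n - j)"
      unfolding g_def using that by (subst gbin_sym) simp_all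
    have s1: "(- 1) ^ (n - j) = (- 1) ^ n * ((- 1) ^ j :: 'a fps)"
      by (simp add: n power_add mult_ac flip: power_mult_distrib)
    have s2: "(- 1) ^ (n + j + 1) = - ((- 1) ^ n * ((- 1) ^ j :: 'a fps))"
      by (simp add: power_add)
    show ?thesis
      unfolding h e1 e2 g s1 s2 c_def rr_term_def
      by (simp only: power_add) (simp add: algebra_simps)
  qed
  hence "(\<Sum>k\<le>2 * n + 1. h k) = c * (\<Sum>j\<le>n. rr_term j * g (n - j))"
    by (simp only: sum_fold_middle) (simp add: sum_distrib_left)
  moreover have "(\<Sum>k\<le>2 * n + 1. h k) = c * P"
    unfolding lhs [symmetric] q_binomial h_def g_def ..
  moreover have "c \<noteq> 0"
    by (simp add: c_def)
  ultimately show ?thesis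
    by (simp add: P_def g_def)
qed

subsection \<open>The second Rogers--Ramanujan identity\<close>

lemma fcong_qpoch:
  assumes "fps_X dvd Q" "m \<le> n"
  shows   "fcong m (qpoch Q m) (qpoch Q n)"
  using assms(2)
proof (induction n rule: dec_induct)
  case (step n)
  have "fps_X ^ m dvd Q ^ Suc n"
    using step.hyps by (intro dvd_trans[OF le_imp_power_dvd dvd_power_same] assms) simp
  hence "fcong m 1 (1 - Q ^ Suc n)"
    by (simp add: fcong_def)
  from fcong_mult[OF step.IH this] show ?case
    by (simp only: qpoch_Suc mult_1_right)
qed simp

lemma fcong_rpoch:
  assumes "m \<le> n"
  shows   "fcong m (rpoch m) (rpoch n :: 'a::comm_ring_1 fps)"
proof -
  have "fcong m (rpoch m * rpoch n * qpoch fps_X n) (rpoch m * rpoch n * qpoch fps_X m :: 'a fps)"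
    by (intro fcong_mult fcong_refl fcong_sym[OF fcong_qpoch] assms) simp
  moreover have "rpoch m * rpoch n * qpoch fps_X n = rpoch m * (qpoch fps_X n * rpoch n :: 'a fps)"
    by (simp only: mult_ac)
  moreover have "rpoch m * rpoch n * qpoch fps_X m = rpoch n * (qpoch fps_X m * rpoch m :: 'a fps)"
    by (simp only: mult_ac)
  ultimately show ?thesis
    by (simp only: qpoch_rpoch mult_1_right)
qed

text \<open>The congruence version of passing to the limit under the summation sign.\<close>

lemma fcong_sum_mult_right:
  assumes "\<And>j. j \<le> n \<Longrightarrow> fps_X ^ j dvd a j" "\<And>j. j \<le> n \<Longrightarrow> fcong (n - j) (b j) c"
  shows   "fcong n (\<Sum>j\<le>n. a j * b j) (c * (\<Sum>j\<le>n. a j))"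
  unfolding sum_distrib_left
proof (rule fcong_sum)
  fix j assume "j \<in> {..n}"
  hence j: "j \<le> n" by simp
  have "fps_X ^ j * fps_X ^ (n - j) dvd a j * (b j - c)"
    using assms[OF j] unfolding fcong_def by (rule mult_dvd_mono)
  thus "fcong n (a j * b j) (c * a j)"
    using j by (simp add: fcong_def algebra_simps flip: power_add)
qed

lemma dvd_rr_term: "fps_X ^ m dvd rr_term m"
  unfolding rr_term_def by (intro dvd_mult2 dvd_mult le_imp_power_dvd) simp

text \<open>The factors sorted by exponent modulo 5: multiples of 5, then the classes 4 and 1 of the
  triple product, then the classes 2 and 3 of the Rogers--Ramanujan product.\<close>

lemma qpoch_5:
  "qpoch fps_X (5 * n) = qpoch (fps_X ^ 5) n * ((\<Prod>k<n. 1 - fps_X ^ (5 * k + 4)) * (\<Prod>k<n. 1 - fps_X ^ (5 * k + 1)))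
     * (\<Prod>k<n. (1 - fps_X ^ (5 * k + 2)) * (1 - fps_X ^ (5 * k + 3)) :: 'a::comm_ring_1 fps)"
proof (induction n)
  case (Suc n)
  have e: "5 * Suc n = Suc (Suc (Suc (Suc (Suc (5 * n)))))"
    by simp
  have p: "(fps_X ^ 5) ^ Suc n = (fps_X ^ Suc (Suc (Suc (Suc (Suc (5 * n))))) :: 'a fps)"
    by (simp only: power_mult [symmetric] e)
  have "qpoch fps_X (5 * Suc n) = qpoch fps_X (5 * n) * (1 - fps_X ^ (5 * n + 1)) * (1 - fps_X ^ (5 * n + 2)) *
          (1 - fps_X ^ (5 * n + 3)) * (1 - fps_X ^ (5 * n + 4)) * (1 - (fps_X ^ 5) ^ Suc n :: 'a fps)"
    by (simp only: e p qpoch_Suc) (simp add: eval_nat_numeral)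
  thus ?case
    unfolding Suc qpoch_Suc prod.lessThan_Suc by (simp only: mult_ac)
qed simp

text \<open>Three congruences are chained: \<open>qpoch fps_X n * S\<close> to \<open>B\<close> by
  the finite identity, \<open>B\<close> to \<open>qpoch Q n * A\<close> by the finite triple
  product, and \<open>qpoch fps_X n\<close> to \<open>qpoch Q n * A * C\<close> by
  \<open>qpoch_5\<close>. Then the unit \<open>qpoch Q n * A\<close> cancels.\<close>

lemma fcong_rogers_ramanujan:
  "fcong n ((\<Sum>s\<le>n. fps_X ^ (s * (s + 1)) * rpoch s) *
     (\<Prod>k<n. (1 - fps_X ^ (5 * k + 2)) * (1 - fps_X ^ (5 * k + 3)))) (1 :: 'a::idom fps)"
proof -
  define S :: "'a fps" where "S = (\<Sum>s\<le>n. fps_X ^ (s * (s + 1)) * rpoch s)"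
  define B :: "'a fps" where "B = (\<Sum>j\<le>n. rr_term j)"
  define A :: "'a fps" where "A = (\<Prod>k<n. 1 - fps_X ^ (5 * k + 4)) * (\<Prod>k<n. 1 - fps_X ^ (5 * k + 1))"
  define C :: "'a fps" where "C = (\<Prod>k<n. (1 - fps_X ^ (5 * k + 2)) * (1 - fps_X ^ (5 * k + 3)))"
  define Q :: "'a fps" where "Q = fps_X ^ 5"
  define r :: "'a fps" where "r = rpoch n"
  have Q: "fps_X dvd Q" "fps_nth Q 0 = 0"
    by (simp_all add: Q_def)
  have q_r: "qpoch fps_X n * r = 1"
    by (simp add: r_def qpoch_rpoch)

  \<comment> \<open>\<open>rpoch (n - s)\<close> agrees with \<open>r\<close> only modulo
    \<open>q^(n-s)\<close>, but its coefficient is divisible by \<open>q^s\<close>, which restores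
    the precision \<open>n\<close>.\<close>
  have "fcong n (r * S) (\<Sum>s\<le>n. (fps_X ^ (s * (s + 1)) * rpoch s) * rpoch (n - s))"
    unfolding S_def r_def
    by (intro fcong_sym[OF fcong_sum_mult_right] fcong_rpoch dvd_mult2 le_imp_power_dvd) auto
  also have "\<dots> = (\<Sum>m\<le>n. rr_term m * (rpoch (n - m) * rpoch (n + m + 1)))"
    using finite_rogers_ramanujan[of n, where 'a='a] by (simp only: mult_ac)
  also have "fcong n \<dots> (r * r * B)"
    unfolding B_def
  proof (intro fcong_sum_mult_right dvd_rr_term fcong_mult)
    fix m assume "m \<le> n"
    show "fcong (n - m) (rpoch (n - m)) r"
      unfolding r_def by (rule fcong_rpoch) simp
    show "fcong (n - m) (rpoch (n + m + 1)) r"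
      unfolding r_def by (rule fcong_sym[OF fcong_mono[OF fcong_rpoch[of n]]]) auto
  qed
  finally have "fcong n (r * S) (r * r * B)" .
  hence "fcong n (qpoch fps_X n * qpoch fps_X n * (r * S)) (qpoch fps_X n * qpoch fps_X n * (r * r * B))"
    by (rule fcong_mult[OF fcong_refl])
  moreover have "qpoch fps_X n * qpoch fps_X n * (r * S) = qpoch fps_X n * S * (qpoch fps_X n * r)"
    by (simp only: mult_ac)
  moreover have "qpoch fps_X n * qpoch fps_X n * (r * r * B) = B * (qpoch fps_X n * r) * (qpoch fps_X n * r)"
    by (simp only: mult_ac)
  ultimately have 1: "fcong n (qpoch fps_X n * S) B"
    by (simp only: q_r mult_1_right)

  \<comment> \<open>The triple product has one more factor than \<open>A\<close>, and that factor is
    1 modulo \<open>q^n\<close>.\<close>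
  have "fcong n (qpoch Q n * (A * 1)) (qpoch Q n * (A * (1 - fps_X ^ (5 * n + 1))))"
    by (intro fcong_mult fcong_refl) (simp add: fcong_def le_imp_power_dvd)
  also have "A * (1 - fps_X ^ (5 * n + 1)) = (\<Sum>j\<le>n. rr_term j * gbin Q (2 * n + 1) (n - j))"
    unfolding Q_def A_def finite_jacobi_triple_product [symmetric] by (simp add: lessThan_Suc_atMost [symmetric] mult_ac)
  also have "qpoch Q n * \<dots> = (\<Sum>j\<le>n. rr_term j * (qpoch Q n * gbin Q (2 * n + 1) (n - j)))"
    by (simp only: sum_distrib_left mult_ac)
  also have "fcong n \<dots> (1 * B)"
    unfolding B_def
  proof (intro fcong_sum_mult_right dvd_rr_term)
    fix j assume j: "j \<le> n"
    define k where "k = n - j"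
    \<comment> \<open>All Pochhammer symbols of index at least \<open>k\<close> agree modulo
      \<open>q^k\<close>, so those in the product formula for the Gaussian binomial may be exchanged
      freely.\<close>
    have q: "fcong k (qpoch Q a) (qpoch Q b)" if "k \<le> a" "k \<le> b" for a b
      using fcong_trans[OF fcong_sym[OF fcong_qpoch[OF Q(1) that(1)]] fcong_qpoch[OF Q(1) that(2)]] .
    have eq: "gbin Q (2 * n + 1) k * qpoch Q k * qpoch Q (2 * n + 1 - k) = qpoch Q (2 * n + 1)"
      by (rule gbin_qpoch) (simp add: k_def)
    have "fcong k (qpoch Q n * gbin Q (2 * n + 1) k * qpoch Q n) (qpoch Q k * gbin Q (2 * n + 1) k * qpoch Q (2 * n + 1 - k))"
      by (intro fcong_mult fcong_refl q) (use j in \<open>auto simp: k_def\<close>)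
    also have "\<dots> = qpoch Q (2 * n + 1)"
      using eq by (simp only: mult_ac)
    also have "fcong k \<dots> (1 * qpoch Q n)"
      unfolding mult_1_left by (rule q) (use j in \<open>auto simp: k_def\<close>)
    finally show "fcong (n - j) (qpoch Q n * gbin Q (2 * n + 1) (n - j)) 1"
      unfolding k_def by (rule fcong_cancel_right) (use qpoch_nth_0 Q in blast)
  qed
  finally have 2: "fcong n B (qpoch Q n * A)"
    by (simp add: fcong_sym)

  have "fcong n (S * C * (qpoch Q n * A)) (S * qpoch fps_X n)"
    using fcong_mult[OF fcong_refl[of n S] fcong_sym[OF fcong_qpoch[of fps_X n "5 * n"]]]
    unfolding qpoch_5 A_def C_def Q_def by (simp add: mult_ac)
  also have "S * qpoch fps_X n = qpoch fps_X n * S"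
    by (rule mult.commute)
  also note 1
  also note 2
  finally have "fcong n (S * C * (qpoch Q n * A)) (1 * (qpoch Q n * A))"
    by (simp only: mult_1_left)
  moreover have "fps_nth (qpoch Q n * A) 0 = 1"
    using qpoch_nth_0[OF Q(2)] by (simp add: A_def fps_prod_nth_0)
  ultimately show ?thesis
    unfolding S_def C_def by (rule fcong_cancel_right)
qed

lemma fcong_one_quot:
  assumes "fcong N g 1" "fps_nth g 0 = 1"
  shows   "fcong N (1 \<oslash> g) 1"
  using fcong_sym[OF assms(1)] assms(2)
  by (intro fcong_cancel_right[of N "1 \<oslash> g" g 1]) (simp_all add: fps_quot_mult_cancel)

lemma fcong_rr_factor:
  "fcong (Suc k) (1 \<oslash> ((1 - fps_X ^ (5 * k + 2)) * (1 - fps_X ^ (5 * k + 3)))) (1 :: 'a::comm_ring_1 fps)"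
proof (rule fcong_one_quot)
  have *: "fcong (Suc k) (1 - fps_X ^ n) (1 :: 'a fps)" if "n > k" for n
    using that le_imp_power_dvd[of "Suc k" n "fps_X :: 'a fps"] by (simp add: fcong_def del: power_Suc)
  have "fcong (Suc k) ((1 - fps_X ^ (5 * k + 2)) * (1 - fps_X ^ (5 * k + 3))) (1 * 1 :: 'a fps)"
    by (intro fcong_mult *) simp_all
  thus "fcong (Suc k) ((1 - fps_X ^ (5 * k + 2)) * (1 - fps_X ^ (5 * k + 3))) (1 :: 'a fps)"
    by (simp only: mult_1_left)
qed simp

lemma dvd_rr_summand: "fps_X ^ k dvd fps_X ^ (k * (k + 1)) * rpoch k"
  by (intro dvd_mult2 le_imp_power_dvd) simp

text \<open>Multiplied by the first \<open>N\<close> denominators, both sides become 1 modulo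
  \<open>q^N\<close>: the series by \<open>fcong_rogers_ramanujan\<close>, the product by
  cancellation.\<close>

theorem second_rogers_ramanujan:
  "(\<Sum>k. fps_X ^ (k * (k + 1)) * rpoch k) =
   (\<Prod>k. 1 \<oslash> ((1 - fps_X ^ (5 * k + 2)) * (1 - fps_X ^ (5 * k + 3))) :: 'a::idom fps)"
  (is "?F = ?P")
proof (rule fcong_eqI)
  fix N
  define g :: "nat \<Rightarrow> 'a fps" where "g k = (1 - fps_X ^ (5 * k + 2)) * (1 - fps_X ^ (5 * k + 3))" for k
  have g0: "fps_nth (g k) 0 = 1" for k
    by (simp add: g_def)
  have "fcong N (?F * (\<Prod>k<N. g k)) ((\<Sum>s\<le>N. fps_X ^ (s * (s + 1)) * rpoch s) * (\<Prod>k<N. g k))"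
    unfolding lessThan_Suc_atMost [symmetric]
    by (intro fcong_mult fcong_refl fcong_mono[OF fcong_suminf[of _ "Suc N"]] dvd_rr_summand) simp
  also have "fcong N \<dots> 1"
    unfolding g_def by (rule fcong_rogers_ramanujan)
  also have "1 = (\<Prod>k<N. 1 \<oslash> g k) * (\<Prod>k<N. g k)"
    unfolding prod.distrib [symmetric] by (simp add: fps_quot_mult_cancel g0)
  also have "fcong N \<dots> (?P * (\<Prod>k<N. g k))"
    unfolding g_def by (intro fcong_mult fcong_refl fcong_sym[OF fcong_prodinf] fcong_rr_factor)
  finally show "fcong N ?F ?P"
    by (rule fcong_cancel_right) (simp add: fps_prod_nth_0 g0)
qed

section \<open>Reduction of the identity to the second Rogers--Ramanujan identity\<close>

theorem theorem4:
  fixes M :: nat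
  assumes "M \<ge> 7" and "M mod 5 = 2 \<or> M mod 5 = 3"
  shows
    "1 + q ^ 2 * ((t + q) \<oslash> (1 - t * q ^ 2))
       + (q ^ 6 \<oslash> ((1 - t * q ^ 2) * (1 - w * q ^ M)))
           * (qint M + (w - 1) * (q ^ (M - 3) + q ^ (M - 6)))
       + (\<Sum>k=3..M-1. (q ^ (k * (k + 1)) \<oslash> ((1 - t * q ^ 2) * (\<Prod>i=3..k. 1 - q ^ i)))
           * (qint M \<oslash> (1 - w * q ^ M)))
       + (\<Sum>j. let k = M + j in
            q ^ (k * (k + 1)) \<oslash>
              ((1 - t * q ^ 2) * (1 - w * q ^ M) * (\<Prod>i\<in>{1..k} - {2, M}. 1 - q ^ i)))
     = ((1 - q ^ M) \<oslash> (1 - w * q ^ M))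
         * (1 \<oslash> ((1 - t * q ^ 2) * (1 - q ^ 3)))
         * (\<Prod>j. let k = j + 1 in 1 \<oslash> ((1 - q ^ (5 * k + 2)) * (1 - q ^ (5 * k + 3))))"
proof -
  define a where "a = 1 - t * q ^ 2"
  define b where "b = 1 - w * q ^ M"
  define f :: "nat \<Rightarrow> int poly poly fps" where "f k = q ^ (k * (k + 1)) * rpoch k" for k
  define u where "u k = q ^ (k * (k + 1)) \<oslash> (a * (\<Prod>i=3..k. 1 - q ^ i))" for k
  define v where "v = qint M \<oslash> b"
  define T where "T = (\<Sum>j. let k = M + j in q ^ (k * (k + 1)) \<oslash> (a * b * (\<Prod>i\<in>{1..k} - {2, M}. 1 - q ^ i)))"
  define P where "P = (\<Prod>j. let k = j + 1 in 1 \<oslash> ((1 - q ^ (5 * k + 2)) * (1 - q ^ (5 * k + 3))))"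
  define F where "F = (\<Sum>k. f k)"
  define R where "R = (\<Sum>j. f (M + j))"
  define S where "S = (\<Sum>k=3..M-1. f k)"
  \<comment> \<open>Multiplication by \<open>a * b\<close> turns the left-hand side into
    \<open>d * F\<close>. The finite sum and the tail yield \<open>d * S\<close> and
    \<open>d * R\<close>; the first three terms yield \<open>d * (1 + f 1 + f 2)\<close> only
    jointly.\<close>
  define d where "d = (1 - q ^ 2) * (1 - q ^ M)"
  define x where "x = (t + q) \<oslash> a"
  define y where "y = q ^ 6 \<oslash> (a * b)"
  define z where "z = (1 - q ^ M) \<oslash> b"
  define z' where "z' = 1 \<oslash> (a * (1 - q ^ 3))"

  have M: "M \<ge> 7" by fact
  have a0: "fps_nth a 0 = 1" and b0: "fps_nth b 0 = 1"
    using M by (simp_all add: a_def b_def)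
  have f_dvd: "fps_X ^ k dvd f k" for k
    unfolding f_def by (rule dvd_rr_summand)
  have f_qpoch: "f k * qpoch q k = q ^ (k * (k + 1))" for k
  proof -
    have "f k * qpoch q k = q ^ (k * (k + 1)) * (qpoch q k * rpoch k)"
      unfolding f_def by (simp only: mult_ac)
    thus ?thesis by (simp only: qpoch_rpoch mult_1_right)
  qed
  have qint: "qint M * (1 - q) = 1 - q ^ M"
    unfolding qint_def one_diff_power_eq by (rule mult.commute)

  \<comment> \<open>The denominator of \<open>u k\<close> lacks the factors \<open>1 - q\<close> and
    \<open>1 - q^2\<close> of \<open>qpoch q k\<close>; \<open>qint M\<close> turns the first into
    \<open>1 - q^M\<close>, which completes \<open>d\<close>.\<close>
  have uv: "u k * v * (a * b) = d * f k" if "k \<ge> 3" for k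
  proof -
    have "{1..k} = insert 1 (insert 2 {3..k})"
      using that by auto
    hence qk: "qpoch q k = (1 - q) * ((1 - q ^ 2) * (\<Prod>i=3..k. 1 - q ^ i))"
      unfolding qpoch_def by simp
    have "u k * (a * (\<Prod>i=3..k. 1 - q ^ i)) = q ^ (k * (k + 1))"
      unfolding u_def by (rule fps_quot_mult_cancel) (simp add: a0 fps_prod_nth_0)
    moreover have "v * b = qint M"
      unfolding v_def by (rule fps_quot_mult_cancel) (rule b0)
    moreover have "u k * v * (a * b) * qpoch q k =
        (u k * (a * (\<Prod>i=3..k. 1 - q ^ i))) * ((v * b) * (1 - q)) * (1 - q ^ 2)"
      unfolding qk by (simp only: mult_ac)
    ultimately have "u k * v * (a * b) * qpoch q k = d * f k * qpoch q k"
      by (simp only: qint d_def mult.assoc f_qpoch) (simp only: mult_ac)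
    moreover have "qpoch q k \<noteq> 0"
      using qpoch_nth_0[of q k] by auto
    ultimately show ?thesis by simp
  qed

  have T: "T * (a * b) = d * R"
  proof -
    \<comment> \<open>The factors missing from the tail denominators, those for \<open>i = 2\<close>
      and \<open>i = M\<close>, multiply to \<open>d\<close>; so every summand is the constant
      \<open>c = d / (a * b)\<close> times \<open>f k\<close>.\<close>
    define c where "c = d * (1 \<oslash> (a * b))"
    have c: "c * (a * b) = d"
      unfolding c_def mult.assoc by (subst fps_quot_mult_cancel) (simp_all add: a0 b0)
    have "q ^ (k * (k + 1)) \<oslash> (a * b * (\<Prod>i\<in>{1..k} - {2, M}. 1 - q ^ i)) = c * f k" if "k \<ge> M" for k
    proof (rule fps_quot_unique)
      have "{1..k} = insert 2 (insert M ({1..k} - {2, M}))"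
        using that M by auto
      hence "qpoch q k = (\<Prod>i\<in>insert 2 (insert M ({1..k} - {2, M})). 1 - q ^ i)"
        unfolding qpoch_def by simp
      also have "\<dots> = d * (\<Prod>i\<in>{1..k} - {2, M}. 1 - q ^ i)"
        using M by (simp add: d_def mult.assoc)
      finally have "q ^ (k * (k + 1)) = f k * (d * (\<Prod>i\<in>{1..k} - {2, M}. 1 - q ^ i))"
        using f_qpoch[of k] by simp
      also have "\<dots> = c * f k * (a * b * (\<Prod>i\<in>{1..k} - {2, M}. 1 - q ^ i))"
        unfolding c [symmetric] by (simp only: mult_ac)
      finally show "c * f k * (a * b * (\<Prod>i\<in>{1..k} - {2, M}. 1 - q ^ i)) = q ^ (k * (k + 1))" ..
    qed (simp add: a0 b0 fps_prod_nth_0)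
    hence "T = (\<Sum>j. c * f (M + j))"
      unfolding T_def Let_def by simp
    also have "\<dots> = c * R"
      unfolding R_def by (rule suminf_fps_cmult) (rule dvd_trans[OF le_imp_power_dvd f_dvd], simp)
    finally have "T * (a * b) = (c * (a * b)) * R"
      by (simp only: mult_ac)
    thus ?thesis by (simp only: c)
  qed

  have f0: "f 0 = 1" by (simp add: f_def)
  have f1: "f 1 * (1 - q) = q ^ 2"
    using f_qpoch[of 1] by (simp add: qpoch_def numeral_2_eq_2)
  have f2: "f 2 * ((1 - q) * (1 - q ^ 2)) = q ^ 6"
  proof -
    have "{1..2::nat} = {1, 2}"
      by auto
    hence "qpoch q 2 = (1 - q) * (1 - q ^ 2)"
      unfolding qpoch_def by simp
    thus ?thesis using f_qpoch[of 2] by simp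
  qed
  have F: "F = 1 + f 1 + f 2 + S + R"
  proof -
    have "{..<M} = insert 0 (insert 1 (insert 2 {3..M-1}))"
      using M by auto
    hence "(\<Sum>k<M. f k) = 1 + f 1 + f 2 + S"
      using f0 by (simp add: S_def add.assoc)
    thus ?thesis
      unfolding F_def R_def using suminf_fps_shift[OF f_dvd, of M] by simp
  qed
  have FP: "F * (1 - q ^ 2) * (1 - q ^ 3) = P"
  proof -
    \<comment> \<open>The Rogers--Ramanujan product starts at \<open>k = 0\<close> and
      \<open>P\<close> at \<open>k = 1\<close>; the extra factor is split off.\<close>
    have "F = 1 \<oslash> ((1 - q ^ 2) * (1 - q ^ 3)) * P"
      unfolding F_def f_def second_rogers_ramanujan
      by (subst prodinf_fps_split_head[OF fcong_rr_factor]) (simp only: P_def Let_def Suc_eq_plus1 mult_0_right add_0_left)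
    hence "F * ((1 - q ^ 2) * (1 - q ^ 3)) = (1 \<oslash> ((1 - q ^ 2) * (1 - q ^ 3))) * ((1 - q ^ 2) * (1 - q ^ 3)) * P"
      by (simp only: mult_ac)
    also have "(1 \<oslash> ((1 - q ^ 2) * (1 - q ^ 3))) * ((1 - q ^ 2) * (1 - q ^ 3)) = 1"
      by (rule fps_quot_mult_cancel) simp
    finally show ?thesis by (simp add: mult.assoc)
  qed

  have xa: "x * a = t + q"
    unfolding x_def by (rule fps_quot_mult_cancel) (rule a0)
  have yab: "y * (a * b) = q ^ 6"
    unfolding y_def by (rule fps_quot_mult_cancel) (simp add: a0 b0)
  have zb: "z * b = 1 - q ^ M"
    unfolding z_def by (rule fps_quot_mult_cancel) (rule b0)
  have za: "z' * (a * (1 - q ^ 3)) = 1"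
    unfolding z'_def by (rule fps_quot_mult_cancel) (simp add: a0)
  have qM: "q ^ 6 * q ^ (M - 3) = q ^ M * q ^ 3" "q ^ 6 * q ^ (M - 6) = q ^ M"
    using M by (simp_all flip: power_add)
  have "(1 - q) * (f 1 * (1 - q ^ 2)) = (1 - q) * (q ^ 2 + q ^ 3)"
  proof -
    have "(1 - q) * (f 1 * (1 - q ^ 2)) = (f 1 * (1 - q)) * (1 - q ^ 2)"
      by (simp only: mult_ac)
    also have "\<dots> = (1 - q) * (q ^ 2 + q ^ 3)"
      unfolding f1 by (simp add: algebra_simps eval_nat_numeral)
    finally show ?thesis .
  qed
  moreover have q1: "(1 - q :: int poly poly fps) \<noteq> 0"
    by (metis fps_X_neq_one eq_iff_diff_eq_0)
  ultimately have f1': "f 1 * (1 - q ^ 2) = q ^ 2 + q ^ 3"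
    by simp
  have f2': "q ^ 6 * qint M = d * f 2"
    unfolding f2 [symmetric] d_def qint [symmetric] by (simp only: mult_ac)
  have sum_uv: "(\<Sum>k=3..M-1. u k * v) * (a * b) = d * S"
    unfolding S_def sum_distrib_left sum_distrib_right by (intro sum.cong refl uv) simp

  have "(1 + q ^ 2 * x + y * (qint M + (w - 1) * (q ^ (M - 3) + q ^ (M - 6)))
           + (\<Sum>k=3..M-1. u k * v) + T) * (a * b) =
        a * b + q ^ 2 * (x * a) * b + y * (a * b) * (qint M + (w - 1) * (q ^ (M - 3) + q ^ (M - 6)))
           + (\<Sum>k=3..M-1. u k * v) * (a * b) + T * (a * b)"
    by (simp only: ring_distribs mult_1_left mult_ac)
  also have "\<dots> = (a + q ^ 2 * (t + q)) * b + (q ^ 6 * qint M + (w - 1) * (q ^ 6 * q ^ (M - 3) + q ^ 6 * q ^ (M - 6)))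
           + d * S + d * R"
    unfolding xa yab sum_uv T by (simp only: ring_distribs mult_ac)
  \<comment> \<open>Here \<open>t\<close> and \<open>w\<close> disappear:
    \<open>a + q^2 (t + q) = 1 + q^3\<close>, and
    \<open>(1 + q^3) b + (w - 1) q^M (1 + q^3) = (1 + q^3) (1 - q^M)\<close>.\<close>
  also have "\<dots> = (1 + q ^ 3) * (1 - q ^ M) + d * f 2 + d * S + d * R"
    unfolding qM f2' by (simp add: a_def b_def algebra_simps eval_nat_numeral)
  also have "(1 + q ^ 3) * (1 - q ^ M) = ((1 - q ^ 2) + f 1 * (1 - q ^ 2)) * (1 - q ^ M)"
    unfolding f1' by simp
  also have "\<dots> + d * f 2 + d * S + d * R = d * F"
    unfolding F by (simp add: d_def algebra_simps)
  \<comment> \<open>Inserting 1 in the form \<open>za\<close> supplies the factor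
    \<open>1 - q^3\<close> that \<open>FP\<close> requires.\<close>
  also have "\<dots> = (1 - q ^ M) * (F * (1 - q ^ 2)) * (z' * (a * (1 - q ^ 3)))"
    unfolding za d_def by (simp only: mult_ac mult_1_left mult_1_right)
  also have "\<dots> = (z * b) * (F * (1 - q ^ 2) * (1 - q ^ 3)) * (z' * a)"
    unfolding zb by (simp only: mult_ac)
  also have "\<dots> = z * z' * P * (a * b)"
    unfolding FP by (simp only: mult_ac)
  finally have "(1 + q ^ 2 * x + y * (qint M + (w - 1) * (q ^ (M - 3) + q ^ (M - 6)))
           + (\<Sum>k=3..M-1. u k * v) + T) * (a * b) = z * z' * P * (a * b)" .
  moreover have "a * b \<noteq> 0"
    using a0 b0 by auto
  ultimately have "1 + q ^ 2 * x + y * (qint M + (w - 1) * (q ^ (M - 3) + q ^ (M - 6)))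
           + (\<Sum>k=3..M-1. u k * v) + T = z * z' * P"
    using mult_right_cancel by blast
  thus ?thesis
    unfolding x_def y_def u_def v_def T_def z_def z'_def P_def a_def b_def .
qed

end
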